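(* Let $D$ be an open simply connected bounded domain in $\mathbb{C}$ with $C^1$-boundary, let $p>2$, and let $u\in L_p(D)$ be complex-valued. Let $N\ge1$ and let $\psi(j)\in W^{1,p}(D)$ and $\psi^+(j)\in W^{1,p}(D)$, $j=1,\ldots,N$, be solutions in $D$ of the equations $$\partial_{\bar z}\psi(j)=u\,\overline{\psi(j)},\qquad \partial_{\bar z}\psi^+(j)=-\overline{u}\,\overline{\psi^+(j)},$$ respectively. For $1\le j,k\le N$ let $\omega_{j,k}$ be purely imaginary-valued functions with $$\partial_z\omega_{j,k}=\psi(j)\,\psi^+(k),\qquad \partial_{\bar z}\omega_{j,k}=-\overline{\psi(j)\,\psi^+(k)}\quad\text{in } D,$$ and let $\Omega$ be the $N\times N$ matrix-valued function whose entry in row $k$ and column $j$ is $\Omega_{k,j}=\omega_{j,k}$. Suppose that $\det\Omega\neq0$ in $D\cup\partial D$. Then the transformed coefficient $$\tilde u=u+\begin{bmatrix}\psi(1)&\ldots&\psi(N)\end{bmatrix}\Omega^{-1}\begin{bmatrix}\overline{\psi^+(1)}\\ \vdots\\ \overline{\psi^+(N)}\end{bmatrix}$$ also satisfies $\tilde u\in L_p(D)$.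
   Context: Here $\partial_z=\frac12(\partial_x-i\partial_y)$ and $\partial_{\bar z}=\frac12(\partial_x+i\partial_y)$ for $z=x+iy$. $W^{1,p}(D)$ is the standard Sobolev space of complex-valued functions, and the equations for $\psi(j)$, $\psi^+(j)$ hold in the sense of weak derivatives (almost everywhere in $D$). The functions $\psi(j)$, $\psi^+(j)$ are identified with their representatives continuous on $D\cup\partial D$ (which exist since $p>2$ and $\partial D$ is $C^1$), and $\omega_{j,k}$ are identified with their continuous extensions to $D\cup\partial D$; this gives meaning to $\det\Omega\ne0$ on $\partial D$. *)

theory Defs
  imports "HOL-Analysis.Analysis"
begin

(* D is locally, after a rotation by a, the strict epigraph of a C1 function on the real line. *)
definition C1_boundary :: "complex set \<Rightarrow> bool" where
  "C1_boundary D \<longleftrightarrow>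
     (\<forall>z0\<in>frontier D. \<exists>a r (\<gamma> :: real \<Rightarrow> real).
        norm a = 1 \<and> r > 0 \<and> \<gamma> C1_differentiable_on UNIV \<and>
        D \<inter> ball z0 r = {z \<in> ball z0 r. Im (a * z) > \<gamma> (Re (a * z))})"

definition Lp :: "real \<Rightarrow> complex set \<Rightarrow> (complex \<Rightarrow> complex) set" where
  "Lp p D = {f. f \<in> borel_measurable (lebesgue_on D) \<and>
                integrable (lebesgue_on D) (\<lambda>z. norm (f z) powr p)}"

definition locally_integrable :: "complex set \<Rightarrow> (complex \<Rightarrow> complex) \<Rightarrow> bool" where
  "locally_integrable D f \<longleftrightarrow> (\<forall>K. compact K \<and> K \<subseteq> D \<longrightarrow> set_integrable lebesgue K f)"

(* Smoothness is real smoothness on the plane; holomorphy is not required. *)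
primrec Ck :: "nat \<Rightarrow> (complex \<Rightarrow> complex) \<Rightarrow> bool" where
  "Ck 0 f \<longleftrightarrow> continuous_on UNIV f"
| "Ck (Suc k) f \<longleftrightarrow>
     (\<exists>f'. (\<forall>z. (f has_derivative f' z) (at z)) \<and> (\<forall>h. Ck k (\<lambda>z. f' z h)))"

definition test_function :: "complex set \<Rightarrow> (complex \<Rightarrow> complex) \<Rightarrow> bool" where
  "test_function D \<phi> \<longleftrightarrow>
     (\<forall>k. Ck k \<phi>) \<and> compact (closure {z. \<phi> z \<noteq> 0}) \<and> closure {z. \<phi> z \<noteq> 0} \<subseteq> D"

(* g is the weak derivative of f on D in direction v; v = 1 is the x- and v = \<i> the y-direction. *)
definition has_weak_deriv ::
    "complex set \<Rightarrow> complex \<Rightarrow> (complex \<Rightarrow> complex) \<Rightarrow> (complex \<Rightarrow> complex) \<Rightarrow> bool" where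
  "has_weak_deriv D v f g \<longleftrightarrow>
     locally_integrable D f \<and> locally_integrable D g \<and>
     (\<forall>\<phi>. test_function D \<phi> \<longrightarrow>
        (LINT z|lebesgue_on D. f z * frechet_derivative \<phi> (at z) v) =
        - (LINT z|lebesgue_on D. g z * \<phi> z))"

definition W1p :: "real \<Rightarrow> complex set \<Rightarrow> (complex \<Rightarrow> complex) set" where
  "W1p p D = {f \<in> Lp p D. \<exists>fx\<in>Lp p D. \<exists>fy\<in>Lp p D.
                has_weak_deriv D 1 f fx \<and> has_weak_deriv D \<i> f fy}"

definition has_weak_dzbar ::
    "complex set \<Rightarrow> (complex \<Rightarrow> complex) \<Rightarrow> (complex \<Rightarrow> complex) \<Rightarrow> bool" where
  "has_weak_dzbar D f g \<longleftrightarrow>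
     (\<exists>fx fy. has_weak_deriv D 1 f fx \<and> has_weak_deriv D \<i> f fy \<and>
        (AE z in lebesgue_on D. (fx z + \<i> * fy z) / 2 = g z))"

definition has_partials ::
    "(complex \<Rightarrow> complex) \<Rightarrow> complex \<Rightarrow> complex \<Rightarrow> complex \<Rightarrow> bool" where
  "has_partials f z fx fy \<longleftrightarrow>
     ((\<lambda>t. f (z + of_real t)) has_vector_derivative fx) (at 0) \<and>
     ((\<lambda>t. f (z + \<i> * of_real t)) has_vector_derivative fy) (at 0)"

definition has_dz :: "(complex \<Rightarrow> complex) \<Rightarrow> complex \<Rightarrow> complex \<Rightarrow> bool" where
  "has_dz f d z \<longleftrightarrow> (\<exists>fx fy. has_partials f z fx fy \<and> d = (fx - \<i> * fy) / 2)"

definition has_dzbar :: "(complex \<Rightarrow> complex) \<Rightarrow> complex \<Rightarrow> complex \<Rightarrow> bool" where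
  "has_dzbar f d z \<longleftrightarrow> (\<exists>fx fy. has_partials f z fx fy \<and> d = (fx + \<i> * fy) / 2)"

(* Row index k, column index j: the entry is \<omega> with its indices swapped. *)
definition Omega_mat ::
    "('n \<Rightarrow> 'n \<Rightarrow> complex \<Rightarrow> complex) \<Rightarrow> complex \<Rightarrow> complex^'n^'n" where
  "Omega_mat \<omega> z = (\<chi> k j. \<omega> j k z)"

definition moutard_coeff ::
    "(complex \<Rightarrow> complex) \<Rightarrow> ('n::finite \<Rightarrow> complex \<Rightarrow> complex) \<Rightarrow>
     ('n \<Rightarrow> complex \<Rightarrow> complex) \<Rightarrow> ('n \<Rightarrow> 'n \<Rightarrow> complex \<Rightarrow> complex) \<Rightarrow> complex \<Rightarrow> complex" where
  "moutard_coeff u \<psi> \<psi>p \<omega> z =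
     u z + (\<Sum>j\<in>UNIV. \<psi> j z * (matrix_inv (Omega_mat \<omega> z) *v (\<chi> k. cnj (\<psi>p k z))) $ j)"

end

theory Submission
  imports Defs
begin

text \<open>
  The correction \<open>\<psi> \<Omega>\<^sup>-\<^sup>1 (cnj \<psi>\<^sup>+)\<close> added to \<open>u\<close> is bounded.
  By Cramer's rule each component of \<open>\<Omega>\<^sup>-\<^sup>1 (cnj \<psi>\<^sup>+)\<close> is a quotient of two determinants in
  functions that are continuous up to the boundary, and its denominator \<open>det \<Omega>\<close> has no zero on
  the closed domain.  So the correction is continuous on the closure of \<open>D\<close>
  (lemma \<open>continuous_on_matrix_inv_vector\<close>).  This closure is compact, since \<open>D\<close> is bounded;
  hence the correction is bounded on \<open>D\<close>, and a bounded continuous perturbation on a set of finite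
  measure stays in \<open>L\<^sub>p\<close> (lemma \<open>Lp_add_continuous_on_closure\<close>).
\<close>

lemma continuous_on_det:
  fixes A :: "'a::topological_space \<Rightarrow> complex^'n^'n"
  assumes "\<And>i j. continuous_on S (\<lambda>x. A x $ i $ j)"
  shows "continuous_on S (\<lambda>x. det (A x))"
  unfolding det_def by (intro continuous_intros assms)

text \<open>
  Inversion is handled through Cramer's rule because this reduces the continuity of the inverse to
  that of determinants, and the pointwise hypothesis \<open>det (A x) \<noteq> 0\<close> becomes the nonvanishing of a
  denominator.
\<close>

lemma continuous_on_matrix_inv_vector:
  fixes A :: "'a::topological_space \<Rightarrow> complex^'n^'n" and b :: "'a \<Rightarrow> complex^'n"
  assumes A: "\<And>i j. continuous_on S (\<lambda>x. A x $ i $ j)"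
    and b: "\<And>i. continuous_on S (\<lambda>x. b x $ i)"
    and det: "\<And>x. x \<in> S \<Longrightarrow> det (A x) \<noteq> 0"
  shows "continuous_on S (\<lambda>x. (matrix_inv (A x) *v b x) $ k)"
proof -
  define B where "B x = (\<chi> i j. if j = k then b x $ i else A x $ i $ j)" for x
  have "(matrix_inv (A x) *v b x) $ k = det (B x) / det (A x)" if "x \<in> S" for x
  proof -
    have "invertible (A x)"
      using det[OF that] by (simp add: invertible_det_nz)
    then have "A x *v (matrix_inv (A x) *v b x) = b x"
      by (simp add: matrix_vector_mul_assoc matrix_inv_def invertible_def
          someI_ex[of "\<lambda>C. A x ** C = mat 1 \<and> C ** A x = mat 1"])
    then show ?thesis
      using cramer[OF det[OF that], of "matrix_inv (A x) *v b x" "b x"]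
      by (simp add: vec_eq_iff B_def)
  qed
  moreover have "continuous_on S (\<lambda>x. B x $ i $ j)" for i j
    unfolding B_def by (cases "j = k") (simp_all add: A b)
  then have "continuous_on S (\<lambda>x. det (B x) / det (A x))"
    by (intro continuous_on_divide continuous_on_det A ballI det)
  ultimately show ?thesis
    by (metis (no_types, lifting) continuous_on_cong)
qed

text \<open>
  Boundedness of \<open>D\<close> is used twice: it makes the closure compact, which bounds the continuous
  summand, and it makes the measure of \<open>D\<close> finite, so that the constant bound is integrable.
\<close>

lemma Lp_add_continuous_on_closure:
  assumes D: "open D" "bounded D" and p: "p \<ge> 0" and f: "f \<in> Lp p D"
    and g: "continuous_on (closure D) g"
  shows "(\<lambda>z. f z + g z) \<in> Lp p D"
proof -
  have "bounded (g ` closure D)"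
    using D g by (intro compact_imp_bounded compact_continuous_image) auto
  then obtain C where C: "\<And>z. z \<in> closure D \<Longrightarrow> norm (g z) \<le> C"
    unfolding bounded_iff by auto
  have Dm: "D \<in> lmeasurable"
    using D by (intro lmeasurable_open)
  interpret finite_measure "lebesgue_on D"
    by (rule finite_measure_lebesgue_on[OF Dm])
  have fm[measurable]: "f \<in> borel_measurable (lebesgue_on D)"
    and fint: "integrable (lebesgue_on D) (\<lambda>z. norm (f z) powr p)"
    using f by (auto simp: Lp_def)
  have gm[measurable]: "g \<in> borel_measurable (lebesgue_on D)"
    using continuous_on_subset[OF g closure_subset] Dm
    by (intro continuous_imp_measurable_on_sets_lebesgue) auto
  (* Bounding the sum by twice the maximum, instead of by convexity of the power, gives a dominating
     function for every nonnegative exponent, including those below 1. *)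
  have "integrable (lebesgue_on D) (\<lambda>z. norm (f z + g z) powr p)"
  proof (rule Bochner_Integration.integrable_bound)
    show "integrable (lebesgue_on D) (\<lambda>z. 2 powr p * (norm (f z) powr p + C powr p))"
      using fint by simp
    show "AE z in lebesgue_on D.
        norm (norm (f z + g z) powr p) \<le> norm (2 powr p * (norm (f z) powr p + C powr p))"
    proof (rule AE_I2)
      fix z assume "z \<in> space (lebesgue_on D)"
      then have gz: "norm (g z) \<le> C"
        using C closure_subset by auto
      let ?m = "max (norm (f z)) C"
      have "norm (f z + g z) \<le> 2 * ?m"
        using norm_triangle_ineq[of "f z" "g z"] gz by linarith
      then have "norm (f z + g z) powr p \<le> (2 * ?m) powr p"
        using p by (intro powr_mono2) auto
      also have "\<dots> = 2 powr p * ?m powr p"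
        by (intro powr_mult)
      also have "\<dots> \<le> 2 powr p * (norm (f z) powr p + C powr p)"
        by (intro mult_left_mono) (auto simp: max_def)
      finally show "norm (norm (f z + g z) powr p)
          \<le> norm (2 powr p * (norm (f z) powr p + C powr p))"
        by simp
    qed
  qed measurable
  then show ?thesis
    by (simp add: Lp_def)
qed

theorem theorem3:
  fixes D :: "complex set" and p :: real and u :: "complex \<Rightarrow> complex"
    and \<psi> \<psi>p :: "'n::finite \<Rightarrow> complex \<Rightarrow> complex"
    and \<omega> :: "'n \<Rightarrow> 'n \<Rightarrow> complex \<Rightarrow> complex"
  assumes "open D" and "D \<noteq> {}" and "connected D" and "simply_connected D" and "bounded D"
    and "C1_boundary D"
    and "p > 2"
    and "u \<in> Lp p D"
    and "\<And>j. \<psi> j \<in> W1p p D" and "\<And>j. continuous_on (D \<union> frontier D) (\<psi> j)"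
    and "\<And>j. \<psi>p j \<in> W1p p D" and "\<And>j. continuous_on (D \<union> frontier D) (\<psi>p j)"
    and "\<And>j. has_weak_dzbar D (\<psi> j) (\<lambda>z. u z * cnj (\<psi> j z))"
    and "\<And>j. has_weak_dzbar D (\<psi>p j) (\<lambda>z. - cnj (u z) * cnj (\<psi>p j z))"
    and "\<And>j k. continuous_on (D \<union> frontier D) (\<omega> j k)"
    and "\<And>j k z. z \<in> D \<Longrightarrow> Re (\<omega> j k z) = 0"
    and "\<And>j k z. z \<in> D \<Longrightarrow> has_dz (\<omega> j k) (\<psi> j z * \<psi>p k z) z"
    and "\<And>j k z. z \<in> D \<Longrightarrow> has_dzbar (\<omega> j k) (- cnj (\<psi> j z * \<psi>p k z)) z"
    and "\<And>z. z \<in> D \<union> frontier D \<Longrightarrow> det (Omega_mat \<omega> z) \<noteq> 0"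
  shows "moutard_coeff u \<psi> \<psi>p \<omega> \<in> Lp p D"
proof -
  have cl: "closure D = D \<union> frontier D"
    using closure_Un_frontier by metis
  have "continuous_on (closure D)
      (\<lambda>z. (matrix_inv (Omega_mat \<omega> z) *v (\<chi> k. cnj (\<psi>p k z))) $ j)" for j
    unfolding cl by (rule continuous_on_matrix_inv_vector)
      (simp_all add: Omega_mat_def[of \<omega>] assms(15,12) continuous_on_cnj
        assms(19)[unfolded Omega_mat_def])
  then have "continuous_on (closure D) (\<lambda>z. \<Sum>j\<in>UNIV. \<psi> j z *
      (matrix_inv (Omega_mat \<omega> z) *v (\<chi> k. cnj (\<psi>p k z))) $ j)"
    using assms(10) by (intro continuous_on_sum continuous_on_mult) (simp_all add: cl)
  then show ?thesis
    unfolding moutard_coeff_def[abs_def]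
    using Lp_add_continuous_on_closure[of D p u] assms(1,5,7,8) by simp
qed

end
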